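(* Assume that the noise terms $\xi_i$ are subgaussian with parameter $\sigma>0$, i.e. $\mathbb E[e^{u\xi_i}]\le e^{u^2\sigma^2/2}$ for all $u\in\mathbb R$. Then for any positive number $q$ there exists a constant $A_q$ (depending only on $q$, $d$ and $\sigma$) such that, for every integer $r\ge d+1$, $$\sup_{P\in\mathcal P_r} \mathbb E_{P}\Big[|\hat P_n^{(r)}\triangle P|^q\Big]\leq A_q\left(\frac{dr\ln n}{n}\right)^q,\qquad \forall n\geq 2.$$
   Context: Let $d\ge 2$ be an integer. One observes $n$ i.i.d. pairs $(X_i,Y_i)$, $i=1,\dots,n$, with $X_i$ uniformly distributed on $[0,1]^d$ and $Y_i=I(X_i\in G)+\xi_i$, where $G\subseteq[0,1]^d$ is unknown, $I(\cdot\in G)$ is the indicator function of $G$, and the errors $\xi_1,\dots,\xi_n$ are i.i.d. real random variables independent of $(X_1,\dots,X_n)$. $\mathbb P_G$ denotes the probability measure associated with the distribution of the $n$ pairs and $\mathbb E_G$ the corresponding expectation. $|\cdot|$ is Lebesgue measure on $\mathbb R^d$ and $\triangle$ is symmetric difference. All convex sets (in particular polytopes) considered are compact with nonempty interior. For $r\ge d+1$, $\mathcal P_r$ is the class of all convex polytopes contained in $[0,1]^d$ with at most $r$ vertices, and $\mathcal P_r^{(n)}$ is the (finite) class of all convex polytopes in $[0,1]^d$ with at most $r$ vertices whose vertices have coordinates that are integer multiples of $1/n$. Put $\mathcal A(P)=\sum_{i=1}^n(1-2Y_i)I(X_i\in P)$. The estimator $\hat P_n^{(r)}$ is any (measurable)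 choice of an element of $\operatorname{argmin}_{P\in\mathcal P_r^{(n)}}\mathcal A(P)$. *)

theory Defs
  imports "HOL-Probability.Probability"
begin

definition unit_cube :: "(real ^ 'd) set" where
  "unit_cube = {x. \<forall>i. 0 \<le> x $ i \<and> x $ i \<le> 1}"

definition vertices :: "(real ^ 'd) set \<Rightarrow> (real ^ 'd) set" where
  "vertices P = {v. v extreme_point_of P}"

definition polytopes :: "nat \<Rightarrow> (real ^ 'd) set set" where
  "polytopes r = {P. polytope P \<and> interior P \<noteq> {} \<and> P \<subseteq> unit_cube \<and> card (vertices P) \<le> r}"

definition grid_polytopes :: "nat \<Rightarrow> nat \<Rightarrow> (real ^ 'd) set set" where
  "grid_polytopes n r =
     {P \<in> polytopes r. \<forall>v \<in> vertices P. \<forall>i. \<exists>k::int. v $ i = of_int k / of_nat n}"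

(* A sample z assigns to each index i in {1..n} the pair z i = (X_i, Y_i). *)

type_synonym 'd sample = "nat \<Rightarrow> (real ^ 'd) \<times> real"

definition criterion :: "nat \<Rightarrow> 'd::finite sample \<Rightarrow> (real ^ 'd) set \<Rightarrow> real" where
  "criterion n z P = (\<Sum>i = 1..n. (1 - 2 * snd (z i)) * indicator P (fst (z i)))"

definition sample_space :: "nat \<Rightarrow> 'd::finite sample measure" where
  "sample_space n = Pi\<^sub>M {1..n} (\<lambda>_. borel)"

(* The law of (X, I(X in G) + xi), with X uniform on the cube and xi distributed as nu,
   independent of X. *)

definition pair_law :: "real measure \<Rightarrow> (real ^ 'd) set \<Rightarrow> ((real ^ 'd) \<times> real) measure" where
  "pair_law \<nu> G =
     distr (uniform_measure lborel unit_cube \<Otimes>\<^sub>M \<nu>) borel (\<lambda>(x, t). (x, indicator G x + t))"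

definition sample_law :: "nat \<Rightarrow> real measure \<Rightarrow> (real ^ 'd::finite) set \<Rightarrow> 'd sample measure" where
  "sample_law n \<nu> G = Pi\<^sub>M {1..n} (\<lambda>_. pair_law \<nu> G)"

(* The class of admissible values is finite, so measurability refers to its discrete
   sigma-algebra. *)

definition is_estimator :: "nat \<Rightarrow> nat \<Rightarrow> ('d::finite sample \<Rightarrow> (real ^ 'd) set) \<Rightarrow> bool" where
  "is_estimator n r Phat \<longleftrightarrow>
     Phat \<in> measurable (sample_space n) (count_space (grid_polytopes n r)) \<and>
     (\<forall>z \<in> space (sample_space n).
        is_arg_min (criterion n z) (\<lambda>P. P \<in> grid_polytopes n r) (Phat z))"

definition subgaussian :: "real \<Rightarrow> real measure \<Rightarrow> bool" where
  "subgaussian \<sigma> \<nu> \<longleftrightarrow>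
     (\<forall>u::real. (\<integral>\<^sup>+ t. ennreal (exp (u * t)) \<partial>\<nu>) \<le> ennreal (exp (u\<^sup>2 * \<sigma>\<^sup>2 / 2)))"

end

theory Submission
  imports Defs
begin

text \<open>Rounding the vertices of the true polytope \<open>G\<close> down to the grid, one coordinate at a time, gives
  a competitor \<open>Q\<close> in the grid class with \<open>|Q \<triangle> G| = O(1/n)\<close>. For a grid polytope \<open>P\<close>,
  an exponential Markov bound on the event that the criterion of \<open>P\<close> does not exceed that of \<open>Q\<close>
  costs a factor \<open>exp (- c |P \<triangle> G| + c' |Q \<triangle> G|)\<close> per observation, so that this event has
  probability at most \<open>C exp (- c n |P \<triangle> G|)\<close>. A union bound over the at most \<open>(n + 1)^(d r)\<close> grid
  polytopes with \<open>|P \<triangle> G|\<close> beyond a multiple of \<open>d r ln n / n\<close> concludes.\<close>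

section \<open>Volume change of convex hulls under coordinatewise rounding\<close>

lemma unit_cube_eq_cbox: "(unit_cube :: (real ^ 'd::finite) set) = cbox 0 (vec 1)"
  by (auto simp: unit_cube_def mem_box_cart)

lemma measure_cbox_vec:
  assumes "a \<le> b"
  shows "measure lebesgue (cbox (vec a) (vec b) :: (real ^ 'd::finite) set) = (b - a) ^ CARD('d)"
proof -
  have "(cbox (vec a) (vec b) :: (real ^ 'd) set) \<noteq> {}"
    using assms by (simp add: interval_ne_empty_cart)
  then show ?thesis
    by (simp add: content_cbox_cart)
qed

lemma measure_sym_diff_triangle:
  fixes A B C :: "'a::euclidean_space set"
  assumes "A \<in> lmeasurable" "B \<in> lmeasurable" "C \<in> lmeasurable"
  shows "measure lebesgue (sym_diff A C)
    \<le> measure lebesgue (sym_diff A B) + measure lebesgue (sym_diff B C)"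
proof -
  have "measure lebesgue (sym_diff A C) \<le> measure lebesgue (sym_diff A B \<union> sym_diff B C)"
    using assms by (intro measure_mono_fmeasurable) (auto intro: fmeasurable.Un fmeasurable.Diff fmeasurableD)
  also have "\<dots> \<le> measure lebesgue (sym_diff A B) + measure lebesgue (sym_diff B C)"
    using assms by (intro measure_Un_le) (auto intro: fmeasurable.Un fmeasurable.Diff fmeasurableD)
  finally show ?thesis .
qed

text \<open>On each line parallel to \<open>u\<close> the set \<open>B - A\<close> lies in a half-open segment of length \<open>norm u\<close>
  ending at \<open>A\<close>, so its \<open>n\<close> translates by multiples of \<open>u\<close> are disjoint.\<close>

lemma measure_Diff_le_of_shift:
  fixes A B :: "(real ^ 'd::finite) set"
  assumes "compact A" "convex A" "compact B" "B \<subseteq> unit_cube" "n \<ge> 1"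
    and u: "\<And>i. \<bar>u $ i\<bar> \<le> 1 / real n"
    and shift: "\<And>x. x \<in> B \<Longrightarrow> \<exists>s\<in>{0..1}. x + s *\<^sub>R u \<in> A"
  shows "measure lebesgue (B - A) \<le> 3 ^ CARD('d) / real n"
proof -
  let ?T = "\<lambda>j::nat. (+) (- (real j *\<^sub>R u)) ` (B - A)"
  have meas: "B - A \<in> lmeasurable"
    using assms by (intro fmeasurable.Diff lmeasurable_compact)
  then have measT: "?T j \<in> lmeasurable" for j
    by (rule measurable_translation)
  have disj0: "?T j \<inter> ?T k = {}" if "j < k" for j k
  proof (rule ccontr)
    assume "?T j \<inter> ?T k \<noteq> {}"
    then obtain x y where x: "x \<in> B - A" and y: "y \<in> B - A"
      and eq: "- (real j *\<^sub>R u) + x = - (real k *\<^sub>R u) + y"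
      by auto
    obtain s where s: "0 \<le> s" "s \<le> 1" "x + s *\<^sub>R u \<in> A" using shift[of x] x by auto
    obtain t where t: "0 \<le> t" "t \<le> 1" "y + t *\<^sub>R u \<in> A" using shift[of y] y by auto
    define m where "m = real k - real j"
    have m: "m \<ge> 1" using that by (simp add: m_def)
    have yx: "y = x + m *\<^sub>R u"
      using eq by (simp add: m_def algebra_simps)
    have "t \<noteq> 0" using t y by auto
    \<comment> \<open>Since \<open>s\<close> \<le> 1 \<le> \<open>m\<close>, the points
      \<open>x + s *\<^sub>R u\<close> and \<open>y + t *\<^sub>R u\<close> of \<open>A\<close>
      enclose \<open>y\<close> on their common line. The weight \<open>w\<close> writes
      \<open>y\<close> as their convex combination, which contradicts \<open>y\<close> lying outside
      the convex set \<open>A\<close>.\<close>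
    define w where "w = t / (m + t - s)"
    have pos: "m + t - s > 0" using m t s \<open>t \<noteq> 0\<close> by simp
    have w: "0 \<le> w" "0 \<le> 1 - w"
      using pos t s m by (auto simp: w_def field_simps)
    have "w * (m + t - s) = t" using pos by (simp add: w_def)
    then have "w * s + (1 - w) * (m + t) = m" by (simp add: algebra_simps)
    moreover have "w *\<^sub>R (x + s *\<^sub>R u) + (1 - w) *\<^sub>R (y + t *\<^sub>R u)
        = x + (w * s + (1 - w) * (m + t)) *\<^sub>R u"
      by (simp add: yx algebra_simps)
    ultimately have "w *\<^sub>R (x + s *\<^sub>R u) + (1 - w) *\<^sub>R (y + t *\<^sub>R u) = y"
      by (simp add: yx)
    with \<open>convex A\<close> s(3) t(3) w have "y \<in> A"
      unfolding convex_def by (metis add_diff_cancel_left' add.commute diff_add_cancel)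
    with y show False by simp
  qed
  then have disj: "pairwise (\<lambda>j k. negligible (?T j \<inter> ?T k)) {..<n}"
    by (auto simp: pairwise_def) (metis Int_commute disj0 linorder_neqE_nat negligible_empty)
  have "measure lebesgue (\<Union>j\<in>{..<n}. ?T j) = (\<Sum>j\<in>{..<n}. measure lebesgue (?T j))"
    by (rule measure_negligible_finite_Union_image[OF _ measT disj]) simp
  also have "\<dots> = real n * measure lebesgue (B - A)"
    by (simp only: measure_translation) simp
  finally have eq: "measure lebesgue (\<Union>j\<in>{..<n}. ?T j) = real n * measure lebesgue (B - A)" .
  \<comment> \<open>A translate with \<open>j < n\<close> moves each coordinate by at most 1, so all
    of them stay within the box with sides [-1, 2]. This is the source of the constant
    \<open>3 ^ CARD('d)\<close>.\<close>
  have sub: "(\<Union>j\<in>{..<n}. ?T j) \<subseteq> cbox (vec (-1)) (vec 2)"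
  proof -
    have "x $ i - real j * u $ i \<in> {-1..2}" if "j < n" "x \<in> B" for j x i
    proof -
      have "x $ i \<in> {0..1}" using \<open>x \<in> B\<close> \<open>B \<subseteq> unit_cube\<close> by (auto simp: unit_cube_def)
      moreover have "\<bar>real j * u $ i\<bar> \<le> 1"
      proof -
        have "\<bar>real j * u $ i\<bar> \<le> real n * (1 / real n)"
          unfolding abs_mult using u[of i] \<open>j < n\<close> by (intro mult_mono) auto
        then show ?thesis using \<open>n \<ge> 1\<close> by simp
      qed
      ultimately show ?thesis
        by (auto simp: abs_le_iff)
    qed
    then show ?thesis by (force simp: mem_box_cart)
  qed
  have "real n * measure lebesgue (B - A) \<le> measure lebesgue (cbox (vec (-1)) (vec 2) :: (real^'d) set)"
    unfolding eq[symmetric]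
    by (rule measure_mono_fmeasurable[OF sub]) (use measT in \<open>auto intro!: sets.finite_UN fmeasurableD\<close>)
  also have "\<dots> = 3 ^ CARD('d)" by (subst measure_cbox_vec) auto
  finally show ?thesis using \<open>n \<ge> 1\<close> by (simp add: field_simps)
qed

text \<open>The points that reach a convex set by travelling a fraction in [0, 1] of a fixed vector
  \<open>u\<close> form a convex set. It therefore suffices to check the generators, provided that
  all of them travel along the same \<open>u\<close>.\<close>

lemma hull_subset_shift:
  fixes f g :: "'a \<Rightarrow> 'b::real_vector"
  assumes "\<And>v. v \<in> V \<Longrightarrow> \<exists>s\<in>{0..1}. g v + s *\<^sub>R u = f v" and "x \<in> convex hull (g ` V)"
  shows "\<exists>s\<in>{0..1}. x + s *\<^sub>R u \<in> convex hull (f ` V)"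
proof -
  let ?A = "convex hull (f ` V)"
  let ?C = "{x. \<exists>s\<in>{0..1}. x + s *\<^sub>R u \<in> ?A}"
  have "convex ?C"
  proof (rule convexI)
    fix x y :: 'b and a b :: real
    assume "x \<in> ?C" "y \<in> ?C" and ab: "0 \<le> a" "0 \<le> b" "a + b = 1"
    then obtain s t where s: "s \<in> {0..1}" "x + s *\<^sub>R u \<in> ?A" and t: "t \<in> {0..1}" "y + t *\<^sub>R u \<in> ?A"
      by auto
    have "a *\<^sub>R (x + s *\<^sub>R u) + b *\<^sub>R (y + t *\<^sub>R u) \<in> ?A"
      using s t ab by (intro convexD[OF convex_convex_hull])
    then have "(a *\<^sub>R x + b *\<^sub>R y) + (a * s + b * t) *\<^sub>R u \<in> ?A"
      by (simp add: algebra_simps)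
    moreover have "a * s + b * t \<in> {0..1}"
      using convexD[OF convex_real_interval(5)[of 0 1] s(1) t(1) ab] by simp
    ultimately show "a *\<^sub>R x + b *\<^sub>R y \<in> ?C" by blast
  qed
  moreover have "g ` V \<subseteq> ?C"
  proof clarify
    fix v assume "v \<in> V"
    then show "\<exists>s\<in>{0..1}. g v + s *\<^sub>R u \<in> ?A" using assms(1) by (metis hull_inc imageI)
  qed
  ultimately have "convex hull (g ` V) \<subseteq> ?C" by (intro hull_minimal)
  with assms(2) show ?thesis by auto
qed

text \<open>The set \<open>S\<close> of coordinates already rounded lets the rounding proceed along
  one axis at a time. Rounding down rather than to the nearest grid value moves all points in the
  same direction, as \<open>hull_subset_shift\<close> requires.\<close>

definition round_down :: "nat \<Rightarrow> 'd set \<Rightarrow> real ^ 'd \<Rightarrow> real ^ 'd" where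
  "round_down n S v = (\<chi> i. if i \<in> S then of_int \<lfloor>real n * v $ i\<rfloor> / real n else v $ i)"

lemma round_down_mem_unit_cube:
  assumes "v \<in> unit_cube" "n \<ge> 1"
  shows "round_down n S v \<in> (unit_cube :: (real ^ 'd::finite) set)"
proof -
  have "0 \<le> of_int \<lfloor>real n * v $ i\<rfloor> / real n \<and> of_int \<lfloor>real n * v $ i\<rfloor> / real n \<le> 1" for i
  proof -
    have "0 \<le> v $ i" "v $ i \<le> 1" using assms by (auto simp: unit_cube_def)
    have "of_int \<lfloor>real n * v $ i\<rfloor> \<le> real n * v $ i" by simp
    also have "\<dots> \<le> real n * 1" using \<open>v $ i \<le> 1\<close> by (intro mult_left_mono) auto
    finally show ?thesis using \<open>0 \<le> v $ i\<close> \<open>n \<ge> 1\<close> by auto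
  qed
  then show ?thesis using assms by (auto simp: round_down_def unit_cube_def)
qed

lemma convex_unit_cube: "convex (unit_cube :: (real ^ 'd::finite) set)"
  by (simp add: unit_cube_eq_cbox convex_box)

lemma round_down_insert:
  assumes "k \<notin> S" "n \<ge> 1"
  shows "\<exists>s\<in>{0..1}. round_down n (insert k S) v + s *\<^sub>R axis k (1 / real n) = round_down n S v"
proof
  let ?s = "frac (real n * v $ k)"
  show "?s \<in> {0..1}" using frac_lt_1[of "real n * v $ k"] by simp
  show "round_down n (insert k S) v + ?s *\<^sub>R axis k (1 / real n) = round_down n S v"
    using assms by (auto simp: vec_eq_iff round_down_def axis_def frac_def field_simps)
qed

text \<open>Rounding one more coordinate \<open>k\<close> moves every generator by a fraction of
  \<open>axis k (1 / real n)\<close>. Read in the two opposite directions, this bounds both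
  one-sided differences of consecutive hulls by \<open>3 ^ CARD('d) / real n\<close>, and the
  triangle inequality adds up the coordinates.\<close>

lemma measure_round_down_hull:
  fixes V :: "(real ^ 'd::finite) set"
  assumes V: "finite V" "V \<subseteq> unit_cube" and n: "n \<ge> 1"
  shows "measure lebesgue (sym_diff (convex hull (round_down n S ` V)) (convex hull V))
    \<le> 2 * real (card S) * 3 ^ CARD('d) / real n"
proof -
  have "finite S" by simp
  then show ?thesis
  proof induction
    case empty
    have "round_down n {} ` V = V" by (simp add: round_down_def)
    then show ?case by simp
  next
    case (insert k S)
    define H where "H = (\<lambda>S. convex hull (round_down n S ` V))"
    have comp: "compact (H S)" "convex (H S)" for S
      using V by (auto simp: H_def intro!: finite_imp_compact_convex_hull)
    have sub: "H S \<subseteq> unit_cube" for S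
      unfolding H_def using V n
      by (intro hull_minimal convex_unit_cube) (auto intro!: round_down_mem_unit_cube)
    let ?u = "axis k (1 / real n) :: real ^ 'd"
    have u: "\<bar>?u $ i\<bar> \<le> 1 / real n" "\<bar>(- ?u) $ i\<bar> \<le> 1 / real n" for i
      by (auto simp: axis_def)
    have m1: "measure lebesgue (H (insert k S) - H S) \<le> 3 ^ CARD('d) / real n"
      by (rule measure_Diff_le_of_shift[OF comp comp(1) sub n u(1)], unfold H_def,
          rule hull_subset_shift[OF round_down_insert[OF insert(2) n]])
    have shift_back: "\<exists>s\<in>{0..1}. round_down n S v + s *\<^sub>R (- ?u) = round_down n (insert k S) v" for v
    proof -
      obtain s where "s \<in> {0..1}" "round_down n (insert k S) v + s *\<^sub>R ?u = round_down n S v"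
        using round_down_insert[OF insert(2) n] by blast
      then show ?thesis by (intro bexI[of _ s]) (auto simp: algebra_simps)
    qed
    have m2: "measure lebesgue (H S - H (insert k S)) \<le> 3 ^ CARD('d) / real n"
      by (rule measure_Diff_le_of_shift[OF comp comp(1) sub n u(2)], unfold H_def,
          rule hull_subset_shift[OF shift_back])
    have "measure lebesgue (sym_diff (H (insert k S)) (H S)) \<le> 2 * 3 ^ CARD('d) / real n"
    proof -
      have "measure lebesgue (sym_diff (H (insert k S)) (H S))
          \<le> measure lebesgue (H (insert k S) - H S) + measure lebesgue (H S - H (insert k S))"
        using comp by (intro measure_Un_le fmeasurableD fmeasurable.Diff lmeasurable_compact)
      with m1 m2 show ?thesis by simp
    qed
    moreover have "measure lebesgue (sym_diff (H S) (convex hull V))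
        \<le> 2 * real (card S) * 3 ^ CARD('d) / real n"
      using insert by (simp add: H_def)
    moreover have "convex hull V \<in> lmeasurable"
      using V by (intro lmeasurable_compact finite_imp_compact_convex_hull)
    ultimately have "measure lebesgue (sym_diff (H (insert k S)) (convex hull V))
        \<le> 2 * 3 ^ CARD('d) / real n + 2 * real (card S) * 3 ^ CARD('d) / real n"
      using measure_sym_diff_triangle[of "H (insert k S)" "H S" "convex hull V"] comp(1)
      by (smt (verit) lmeasurable_compact)
    then show ?case using insert by (simp add: H_def add_divide_distrib algebra_simps)
  qed
qed

section \<open>Polytopes in the cube: grid approximation and size of the grid class\<close>

lemma polytopesD:
  assumes "P \<in> polytopes r"
  shows "polytope P" "compact P" "convex P" "interior P \<noteq> {}" "P \<subseteq> unit_cube" "finite (vertices P)"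
    "card (vertices P) \<le> r" "P = convex hull (vertices P)" "vertices P \<subseteq> unit_cube"
    "vertices P \<noteq> {}"
proof -
  show P: "polytope P" "P \<subseteq> unit_cube" "interior P \<noteq> {}" "card (vertices P) \<le> r"
    using assms by (auto simp: polytopes_def)
  show c: "compact P" "convex P"
    using P by (auto simp: polytope_imp_compact polytope_imp_convex)
  show "finite (vertices P)"
    unfolding vertices_def
    using P(1) by (metis finite_polyhedron_extreme_points polytope_imp_polyhedron)
  show hull: "P = convex hull (vertices P)"
    unfolding vertices_def using Krein_Milman_Minkowski[OF c] .
  show "vertices P \<subseteq> unit_cube"
    using P by (auto simp: vertices_def extreme_point_of_def)
  show "vertices P \<noteq> {}"
    using hull P(3) by (metis convex_hull_empty interior_empty)
qed

lemma hull_mem_polytopes: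
  assumes "finite V" "card V \<le> r" "V \<subseteq> unit_cube" "interior (convex hull V) \<noteq> {}"
  shows "convex hull V \<in> polytopes r"
proof -
  have sub: "vertices (convex hull V) \<subseteq> V"
    by (auto simp: vertices_def dest: extreme_point_of_convex_hull)
  then have "card (vertices (convex hull V)) \<le> r"
    using assms by (meson card_mono le_trans)
  moreover have "convex hull V \<subseteq> unit_cube"
    using assms by (intro hull_minimal convex_unit_cube)
  ultimately show ?thesis
    using assms by (auto simp: polytopes_def polytope_def)
qed

lemma hull_mem_grid_polytopes:
  assumes "finite V" "card V \<le> r" "V \<subseteq> unit_cube" "interior (convex hull V) \<noteq> {}"
    and "\<And>v i. v \<in> V \<Longrightarrow> \<exists>k::int. v $ i = of_int k / of_nat n"
  shows "convex hull V \<in> grid_polytopes n r"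
proof -
  have "vertices (convex hull V) \<subseteq> V"
    by (auto simp: vertices_def dest: extreme_point_of_convex_hull)
  then show ?thesis using assms hull_mem_polytopes[OF assms(1-4)] by (auto simp: grid_polytopes_def)
qed

text \<open>A nondegenerate fallback competitor: the standard simplex scaled by
  \<open>1 / real n\<close> fits in a cube of side \<open>1 / real n\<close>. Its
  \<open>CARD('d) + 1\<close> vertices are what the lower bound on \<open>r\<close> makes room
  for.\<close>

lemma small_grid_simplex:
  assumes "n \<ge> 1" "r \<ge> CARD('d::finite) + 1"
  obtains Q :: "(real ^ 'd) set" where "Q \<in> grid_polytopes n r" "measure lebesgue Q \<le> 1 / real n"
proof -
  let ?V = "(\<lambda>x. (1 / real n) *\<^sub>R x) ` (insert 0 Basis) :: (real ^ 'd) set"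
  let ?Q = "convex hull ?V"
  have Qe: "?Q = (\<lambda>x. (1 / real n) *\<^sub>R x) ` (convex hull (insert 0 Basis))"
    by (rule convex_hull_scaling)
  have "card ?V \<le> card (insert 0 (Basis :: (real ^ 'd) set))" by (rule card_image_le) simp
  also have "\<dots> \<le> r" using assms by (simp add: card_insert_if)
  finally have card: "card ?V \<le> r" .
  have box: "?V \<subseteq> cbox (vec 0) (vec (1 / real n))"
    using assms by (auto simp: mem_box_cart Basis_vec_def axis_def)
  have "cbox (vec 0) (vec (1 / real n)) \<subseteq> (unit_cube :: (real ^ 'd) set)"
  proof -
    have "1 / real n \<le> 1" using assms by simp
    then show ?thesis by (auto simp: unit_cube_def mem_box_cart) (meson order_trans)
  qed
  with box have cube: "?V \<subseteq> unit_cube" by blast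
  have "interior ?Q = (\<lambda>x. (1 / real n) *\<^sub>R x) ` interior (convex hull (insert 0 Basis))"
    unfolding Qe using assms by (intro interior_injective_linear_image) (auto simp: linear_iff inj_def algebra_simps)
  then have int: "interior ?Q \<noteq> {}"
    using interior_std_simplex_nonempty by auto
  have "?Q \<in> grid_polytopes n r"
  proof (rule hull_mem_grid_polytopes[OF _ card cube int])
    fix v i assume "v \<in> ?V"
    then have "v $ i = of_int 0 / of_nat n \<or> v $ i = of_int 1 / of_nat n"
      by (auto simp: Basis_vec_def axis_def)
    then show "\<exists>k::int. v $ i = of_int k / of_nat n" by blast
  qed simp
  moreover have "measure lebesgue ?Q \<le> 1 / real n"
  proof -
    have "?Q \<subseteq> cbox (vec 0) (vec (1 / real n))" using box by (intro hull_minimal convex_box) auto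
    then have "measure lebesgue ?Q \<le> measure lebesgue (cbox (vec 0) (vec (1 / real n)) :: (real ^ 'd) set)"
      by (intro measure_mono_fmeasurable)
        (auto intro!: fmeasurableD lmeasurable_compact finite_imp_compact_convex_hull)
    also have "\<dots> = (1 / real n) ^ CARD('d)" by (subst measure_cbox_vec) auto
    also have "\<dots> \<le> (1 / real n) ^ 1"
      using assms by (intro power_decreasing) (auto simp: Suc_le_eq)
    finally show ?thesis by simp
  qed
  ultimately show ?thesis using that by blast
qed

lemma grid_approximation:
  fixes P :: "(real ^ 'd::finite) set"
  assumes P: "P \<in> polytopes r" and n: "n \<ge> 1" and r: "r \<ge> CARD('d) + 1"
  obtains Q where "Q \<in> grid_polytopes n r"
    "measure lebesgue (sym_diff Q P) \<le> (2 * real CARD('d) * 3 ^ CARD('d) + 1) / real n"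
proof -
  note P = polytopesD[OF P]
  txt \<open>If the rounded polytope is degenerate, then \<open>P\<close> itself is small and any small grid simplex will do.\<close>
  let ?V = "round_down n UNIV ` vertices P"
  let ?H = "convex hull ?V"
  have le: "measure lebesgue (sym_diff ?H P) \<le> 2 * real CARD('d) * 3 ^ CARD('d) / real n"
    using measure_round_down_hull[OF P(6) P(9) n, of UNIV] P(8) by simp
  have comp: "compact ?H" using P(6) by (intro finite_imp_compact_convex_hull) simp
  show ?thesis
  proof (cases "interior ?H = {}")
    case False
    have "?H \<in> grid_polytopes n r"
    proof (rule hull_mem_grid_polytopes)
      show "card ?V \<le> r" using P(6,7) by (meson card_image_le le_trans)
      show "?V \<subseteq> unit_cube" using P(9) n by (auto intro!: round_down_mem_unit_cube)
    qed (use False P(6) in \<open>auto simp: round_down_def\<close>)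
    moreover have "measure lebesgue (sym_diff ?H P) \<le> (2 * real CARD('d) * 3 ^ CARD('d) + 1) / real n"
      using le unfolding add_divide_distrib by (rule add_increasing2[rotated]) simp
    ultimately show ?thesis using that by blast
  next
    case True
    then have "negligible ?H" using negligible_convex_interior by blast
    obtain Q :: "(real ^ 'd) set" where Q: "Q \<in> grid_polytopes n r" "measure lebesgue Q \<le> 1 / real n"
      using small_grid_simplex[OF n r] .
    have "compact Q" using Q(1) polytopesD(2) by (auto simp: grid_polytopes_def)
    have lm: "Q \<in> lmeasurable" "P \<in> lmeasurable" "?H \<in> lmeasurable"
      using \<open>compact Q\<close> P(2) comp by (auto intro: lmeasurable_compact)
    \<comment> \<open>The null set \<open>?H\<close> serves as the intermediate set: it is close to
      \<open>P\<close> by the rounding bound and differs from \<open>Q\<close> by at most the volume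
      of \<open>Q\<close>. That volume accounts for the summand 1 in the final constant.\<close>
    have "measure lebesgue (sym_diff Q ?H) \<le> measure lebesgue (Q \<union> ?H)"
      using lm by (intro measure_mono_fmeasurable) (auto intro: fmeasurable.Un fmeasurable.Diff fmeasurableD)
    also have "\<dots> \<le> measure lebesgue Q + measure lebesgue ?H"
      using lm by (intro measure_Un_le) (auto intro: fmeasurableD)
    also have "\<dots> \<le> 1 / real n" using Q(2) \<open>negligible ?H\<close> by (simp add: negligible_imp_measure0)
    finally have "measure lebesgue (sym_diff Q P) \<le> (2 * real CARD('d) * 3 ^ CARD('d) + 1) / real n"
      using measure_sym_diff_triangle[OF lm(1) lm(3) lm(2)] le by (simp add: add_divide_distrib)
    with Q(1) show ?thesis using that by blast
  qed
qed

text \<open>A polytope is the hull of its vertices, so it is determined by a list of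
  \<open>r\<close> grid points, repetitions allowed. In the cube each coordinate has
  \<open>n + 1\<close> possible values, which leaves \<open>(n + 1) ^ CARD('d)\<close> choices for
  each entry of the list.\<close>

lemma grid_polytopes_finite_card:
  assumes n: "n \<ge> 1"
  shows "finite (grid_polytopes n r :: (real ^ 'd::finite) set set)"
    and "card (grid_polytopes n r :: (real ^ 'd) set set) \<le> (n + 1) ^ (CARD('d) * r)"
proof -
  let ?F = "PiE (UNIV :: 'd set) (\<lambda>_. {0..n})"
  let ?W = "(\<lambda>f. (\<chi> i. real (f i) / real n) :: real ^ 'd) ` ?F"
  have F: "finite ?F" "card ?F = (n + 1) ^ CARD('d)"
    by (auto intro!: finite_PiE simp: card_PiE)
  have W: "finite ?W" "card ?W \<le> (n + 1) ^ CARD('d)"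
    using F card_image_le[OF F(1)] by auto
  let ?E = "PiE {..<r} (\<lambda>_. ?W)"
  have "card ?E = card ?W ^ r" by (simp add: card_PiE)
  also have "\<dots> \<le> ((n + 1) ^ CARD('d)) ^ r" using W(2) by (rule power_mono) simp
  finally have E: "finite ?E" "card ?E \<le> (n + 1) ^ (CARD('d) * r)"
    using W(1) by (auto intro!: finite_PiE simp: power_mult)
  have sub: "grid_polytopes n r \<subseteq> (\<lambda>g. convex hull (g ` {..<r})) ` ?E"
  proof
    fix P :: "(real ^ 'd) set" assume "P \<in> grid_polytopes n r"
    then have P: "P \<in> polytopes r" and grid: "\<And>v i. v \<in> vertices P \<Longrightarrow> \<exists>k::int. v $ i = of_int k / of_nat n"
      by (auto simp: grid_polytopes_def)
    note P = polytopesD[OF P]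
    have VW: "vertices P \<subseteq> ?W"
    proof
      fix v assume v: "v \<in> vertices P"
      then obtain k :: "'d \<Rightarrow> int" where k: "\<And>i. v $ i = of_int (k i) / of_nat n"
        using grid[OF v] by metis
      have k01: "0 \<le> k i \<and> k i \<le> int n" for i
      proof -
        have "0 \<le> v $ i" "v $ i \<le> 1" using P(9) v by (auto simp: unit_cube_def)
        then show ?thesis using n by (auto simp: k field_simps)
      qed
      have "v = (\<chi> i. real (nat (k i)) / real n)"
        using k k01 by (simp add: vec_eq_iff)
      moreover have "(\<lambda>i. nat (k i)) \<in> ?F" using k01 by (auto simp: nat_le_iff)
      ultimately show "v \<in> ?W" by (rule image_eqI)
    qed
    obtain h where h: "bij_betw h {0..<card (vertices P)} (vertices P)"
      using ex_bij_betw_nat_finite[OF P(6)] by blast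
    let ?c = "card (vertices P)"
    have c: "0 < ?c" "?c \<le> r" using P(6,7,10) by (auto simp: card_gt_0_iff)
    \<comment> \<open>The enumeration of the vertices is padded to length exactly \<open>r\<close>
      by repeating the vertex \<open>h 0\<close>, which exists because there is at least one
      vertex.\<close>
    let ?g = "\<lambda>i\<in>{..<r}. h (if i < ?c then i else 0)"
    have "?g ` {..<r} = h ` {0..<?c}"
    proof
      show "?g ` {..<r} \<subseteq> h ` {0..<?c}" using c by auto
      show "h ` {0..<?c} \<subseteq> ?g ` {..<r}" using c by (force simp: image_iff)
    qed
    then have g: "?g ` {..<r} = vertices P" using h by (simp add: bij_betw_def)
    have "?g \<in> ?E"
    proof (rule PiE_I)
      fix i assume "i \<in> {..<r}"
      then have "?g i \<in> vertices P" using g by blast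
      then show "?g i \<in> ?W" using VW by blast
    qed auto
    moreover have "P = convex hull (?g ` {..<r})" using g P(8) by simp
    ultimately show "P \<in> (\<lambda>g. convex hull (g ` {..<r})) ` ?E" by blast
  qed
  show "finite (grid_polytopes n r :: (real ^ 'd) set set)"
    using sub E(1) by (meson finite_imageI finite_subset)
  show "card (grid_polytopes n r :: (real ^ 'd) set set) \<le> (n + 1) ^ (CARD('d) * r)"
    using E sub by (meson card_image_le card_mono finite_imageI le_trans)
qed

section \<open>The law of one observation\<close>

lemma emeasure_unit_cube: "emeasure lborel (unit_cube :: (real ^ 'd::finite) set) = 1"
proof -
  have "measure lebesgue (cbox (vec 0) (vec 1) :: (real ^ 'd) set) = 1"
    by (subst measure_cbox_vec) auto
  then show ?thesis
    unfolding unit_cube_eq_cbox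
    by (simp add: emeasure_eq_ennreal_measure vec_0 fmeasurableD2)
qed

lemma unit_cube_sets [measurable]: "(unit_cube :: (real ^ 'd::finite) set) \<in> sets borel"
  by (simp add: unit_cube_eq_cbox)

lemma prob_space_uniform_cube: "prob_space (uniform_measure lborel (unit_cube :: (real ^ 'd::finite) set))"
  by (rule prob_space_uniform_measure) (simp_all add: emeasure_unit_cube)

lemma measurable_observation:
  fixes G :: "(real ^ 'd::finite) set" and \<nu> :: "real measure"
  assumes [measurable_cong]: "sets \<nu> = sets borel" and [measurable]: "G \<in> sets borel"
  shows "(\<lambda>(x, t). (x, indicator G x + t)) \<in> borel_measurable (uniform_measure lborel unit_cube \<Otimes>\<^sub>M \<nu>)"
proof -
  have [measurable_cong]: "sets (uniform_measure lborel (unit_cube :: (real ^ 'd) set)) = sets borel" by simp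
  show ?thesis unfolding case_prod_unfold by (intro borel_measurable_Pair) measurable
qed

lemma sets_pair_law [simp]: "sets (pair_law \<nu> G) = sets borel"
  by (simp add: pair_law_def)

lemma prob_space_pair_law:
  fixes G :: "(real ^ 'd::finite) set"
  assumes "prob_space \<nu>" "sets \<nu> = sets borel" "G \<in> sets borel"
  shows "prob_space (pair_law \<nu> G)"
proof -
  interpret U: prob_space "uniform_measure lborel (unit_cube :: (real ^ 'd) set)"
    by (rule prob_space_uniform_cube)
  interpret N: prob_space \<nu> by fact
  interpret pair_prob_space "uniform_measure lborel (unit_cube :: (real ^ 'd) set)" \<nu> ..
  show ?thesis unfolding pair_law_def
    by (rule prob_space_distr[OF measurable_observation[OF assms(2,3)]])
qed

section \<open>Exponential moments of criterion differences\<close>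

text \<open>This is what one observation contributes to the difference of the criteria of
  \<open>P\<close> and \<open>Q\<close>. Under the product law the contributions are i.i.d., so
  exponential moments of the difference factorize.\<close>

definition loss_increment :: "(real ^ 'd) set \<Rightarrow> (real ^ 'd) set \<Rightarrow> (real ^ 'd::finite) \<times> real \<Rightarrow> real" where
  "loss_increment P Q p = (1 - 2 * snd p) * (indicator P (fst p) - indicator Q (fst p))"

lemma criterion_diff: "criterion n z P - criterion n z Q = (\<Sum>i=1..n. loss_increment P Q (z i))"
  by (simp add: criterion_def loss_increment_def sum_subtractf[symmetric] algebra_simps)

lemma loss_increment_measurable [measurable]:
  assumes [measurable]: "P \<in> sets borel" "Q \<in> sets borel"
  shows "loss_increment P Q \<in> borel_measurable borel"
  unfolding loss_increment_def borel_prod[symmetric] by measurable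

text \<open>The choice \<open>l = 1 / (4 * \<sigma>\<^sup>2)\<close> turns the subgaussian factor \<open>exp (2 * l\<^sup>2 * \<sigma>\<^sup>2)\<close> into \<open>exp (l / 2)\<close>.\<close>

lemma nn_integral_exp_loss_increment_noise:
  assumes nu: "sets \<nu> = sets borel" "prob_space \<nu>" "subgaussian \<sigma> \<nu>" "\<sigma> > 0" and l: "l = 1 / (4 * \<sigma>\<^sup>2)"
  shows "(\<integral>\<^sup>+ t. ennreal (exp (- l * loss_increment P Q (x, indicator G x + t))) \<partial>\<nu>)
    \<le> ennreal (1 - (1 - exp (- l / 2)) * indicator (sym_diff P G) x
                 + (exp (3 * l / 2) - exp (- l / 2)) * indicator (sym_diff Q G) x)"
proof -
  interpret prob_space \<nu> by fact
  \<comment> \<open>For fixed \<open>x\<close> the exponent is affine in the noise: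
    \<open>- l * (1 - 2 * g) * D + (2 * l * D) * t\<close>. The subgaussian bound is thus applied at
    \<open>u = 2 * l * D\<close>.\<close>
  define g D :: real where "g = indicator G x" and "D = indicator P x - indicator Q x"
  have "(\<integral>\<^sup>+ t. ennreal (exp (- l * loss_increment P Q (x, indicator G x + t))) \<partial>\<nu>)
      = (\<integral>\<^sup>+ t. ennreal (exp (- l * (1 - 2 * g) * D)) * ennreal (exp ((2 * l * D) * t)) \<partial>\<nu>)"
    by (intro nn_integral_cong)
      (simp add: loss_increment_def g_def D_def ennreal_mult[symmetric] exp_add[symmetric] algebra_simps)
  also have "\<dots> = ennreal (exp (- l * (1 - 2 * g) * D)) * (\<integral>\<^sup>+ t. ennreal (exp ((2 * l * D) * t)) \<partial>\<nu>)"
    using nu(1) by (intro nn_integral_cmult) (simp add: measurable_cong_sets[OF nu(1) refl])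
  also have "\<dots> \<le> ennreal (exp (- l * (1 - 2 * g) * D)) * ennreal (exp ((2 * l * D)\<^sup>2 * \<sigma>\<^sup>2 / 2))"
    using nu(3) unfolding subgaussian_def by (intro mult_left_mono) auto
  also have "\<dots> = ennreal (exp (- l * (1 - 2 * g) * D + l / 2 * D\<^sup>2))"
  proof -
    have "(2 * l * D)\<^sup>2 * \<sigma>\<^sup>2 / 2 = l / 2 * D\<^sup>2"
      using nu(4) by (simp add: l power2_eq_square field_simps)
    then show ?thesis by (simp add: ennreal_mult[symmetric] exp_add[symmetric])
  qed
  also have "\<dots> \<le> ennreal (1 - (1 - exp (- l / 2)) * indicator (sym_diff P G) x
                 + (exp (3 * l / 2) - exp (- l / 2)) * indicator (sym_diff Q G) x)"
  proof (rule ennreal_leI)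
    have lp: "l > 0" using nu(4) by (simp add: l)
    have e: "exp (- l / 2) \<le> 1" "1 \<le> exp (3 * l / 2)" "- l + l / 2 = - l / 2" "l + l / 2 = 3 * l / 2"
      using lp by (auto simp: field_simps)
    show "exp (- l * (1 - 2 * g) * D + l / 2 * D\<^sup>2) \<le> 1 - (1 - exp (- l / 2)) * indicator (sym_diff P G) x
                 + (exp (3 * l / 2) - exp (- l / 2)) * indicator (sym_diff Q G) x"
      \<comment> \<open>If \<open>x\<close> lies only in \<open>sym_diff P G\<close>, the exponent
        is \<open>- l / 2\<close> and equality holds. If it lies only in
        \<open>sym_diff Q G\<close>, the exponent is \<open>3 * l / 2\<close> and the right side
        exceeds its exponential by \<open>1 - exp (- l / 2)\<close>. In both or neither,
        \<open>D = 0\<close> and the right side is \<open>exp (3 * l / 2)\<close> or 1.\<close>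
      using e by (cases "x \<in> G"; cases "x \<in> P"; cases "x \<in> Q") (auto simp: g_def D_def)
  qed
  finally show ?thesis .
qed

text \<open>The bound for fixed \<open>x\<close> is affine in two indicators, so averaging over the
  uniform \<open>x\<close> replaces them by volumes, the cube having volume 1. The inequality 1 + y
  \<le> exp y then gives a form that multiplies well over the sample.\<close>

lemma nn_integral_exp_loss_increment:
  fixes P Q G :: "(real ^ 'd::finite) set"
  assumes nu: "sets \<nu> = sets borel" "prob_space \<nu>" "subgaussian \<sigma> \<nu>" "\<sigma> > 0" and l: "l = 1 / (4 * \<sigma>\<^sup>2)"
    and [measurable]: "P \<in> sets borel" "Q \<in> sets borel" "G \<in> sets borel"
    and cube: "P \<subseteq> unit_cube" "Q \<subseteq> unit_cube" "G \<subseteq> unit_cube"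
  shows "(\<integral>\<^sup>+ p. ennreal (exp (- l * loss_increment P Q p)) \<partial>pair_law \<nu> G)
    \<le> ennreal (exp (- (1 - exp (- l / 2)) * measure lebesgue (sym_diff P G)
                 + (exp (3 * l / 2) - exp (- l / 2)) * measure lebesgue (sym_diff Q G)))"
proof -
  let ?U = "uniform_measure lborel (unit_cube :: (real ^ 'd) set)"
  interpret U: prob_space ?U by (rule prob_space_uniform_cube)
  interpret N: prob_space \<nu> by fact
  interpret pair_prob_space ?U \<nu> ..
  note [measurable_cong] = nu(1)
  have [measurable_cong]: "sets ?U = sets borel" by simp
  define c1 c3 where "c1 = 1 - exp (- l / 2)" and "c3 = exp (3 * l / 2) - exp (- l / 2)"
  have lp: "l > 0" using nu(4) by (simp add: l)
  have c: "0 \<le> c1" "c1 \<le> 1" "0 \<le> c3" using lp by (auto simp: c1_def c3_def)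
  have meas_U: "measure ?U A = measure lebesgue A" if "A \<in> sets borel" "A \<subseteq> unit_cube" for A
  proof -
    have "emeasure ?U A = emeasure lborel A"
      using that by (simp add: emeasure_unit_cube inf_absorb2 divide_ennreal_def)
    then show ?thesis using that by (simp add: measure_def)
  qed
  have [measurable]: "sym_diff P G \<in> sets borel" "sym_diff Q G \<in> sets borel" by measurable
  let ?f = "\<lambda>x. 1 - c1 * indicator (sym_diff P G) x + c3 * indicator (sym_diff Q G) x :: real"
  have "(\<integral>\<^sup>+ p. ennreal (exp (- l * loss_increment P Q p)) \<partial>pair_law \<nu> G)
      = (\<integral>\<^sup>+ (x, t). ennreal (exp (- l * loss_increment P Q (x, indicator G x + t))) \<partial>(?U \<Otimes>\<^sub>M \<nu>))"
    unfolding pair_law_def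
    by (subst nn_integral_distr[OF measurable_observation[OF nu(1)]]) (auto simp: case_prod_unfold)
  also have "\<dots> = (\<integral>\<^sup>+ x. \<integral>\<^sup>+ t. ennreal (exp (- l * loss_increment P Q (x, indicator G x + t))) \<partial>\<nu> \<partial>?U)"
  proof (subst N.nn_integral_fst[symmetric])
    have "(\<lambda>p. ennreal (exp (- l * loss_increment P Q p)))
        \<circ> (\<lambda>(x, t). (x, indicator G x + t)) \<in> borel_measurable (?U \<Otimes>\<^sub>M \<nu>)"
      by (rule measurable_comp[OF measurable_observation[OF nu(1)]]) measurable
    then show "(\<lambda>(x, t). ennreal (exp (- l * loss_increment P Q (x, indicator G x + t))))
        \<in> borel_measurable (?U \<Otimes>\<^sub>M \<nu>)"
      by (simp add: comp_def case_prod_unfold)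
  qed simp
  also have "\<dots> \<le> (\<integral>\<^sup>+ x. ennreal (?f x) \<partial>?U)"
    unfolding c1_def c3_def
    by (intro nn_integral_mono nn_integral_exp_loss_increment_noise[OF nu l])
  also have "\<dots> = ennreal (\<integral>x. ?f x \<partial>?U)"
  proof (rule nn_integral_eq_integral)
    show "integrable ?U ?f"
      by (intro U.integrable_const_bound[where B = "2 + c3"])
        (use c in \<open>auto simp: indicator_def\<close>)
    show "AE x in ?U. 0 \<le> ?f x" using c by (auto simp: indicator_def)
  qed
  also have "(\<integral>x. ?f x \<partial>?U) = 1 - c1 * measure lebesgue (sym_diff P G) + c3 * measure lebesgue (sym_diff Q G)"
  proof -
    have i: "integrable ?U (\<lambda>x. indicator A x :: real)" if "A \<in> sets borel" for A
      using that by (intro U.integrable_const_bound[where B = 1]) (auto simp: indicator_def)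
    have m: "measure ?U (sym_diff P G) = measure lebesgue (sym_diff P G)"
      "measure ?U (sym_diff Q G) = measure lebesgue (sym_diff Q G)"
      by (rule meas_U; use cube in force)+
    have "(\<integral>x. ?f x \<partial>?U) = 1 - c1 * measure ?U (sym_diff P G) + c3 * measure ?U (sym_diff Q G)"
      using U.prob_space by (simp add: i del: indicator_simps)
    then show ?thesis unfolding m .
  qed
  also have "\<dots> \<le> exp (- c1 * measure lebesgue (sym_diff P G) + c3 * measure lebesgue (sym_diff Q G))"
    using exp_ge_add_one_self[of "- c1 * measure lebesgue (sym_diff P G) + c3 * measure lebesgue (sym_diff Q G)"]
    by linarith
  finally show ?thesis unfolding c1_def c3_def by (simp add: ennreal_leI)
qed

text \<open>The integrand is at least 1 wherever the criterion of \<open>P\<close> does not exceed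
  that of \<open>Q\<close>, so this is the exponential Markov bound for that event. Independence
  raises the bound for one observation to the power \<open>n\<close>.\<close>

lemma nn_integral_exp_criterion:
  fixes P Q G :: "(real ^ 'd::finite) set"
  assumes nu: "sets \<nu> = sets borel" "prob_space \<nu>" "subgaussian \<sigma> \<nu>" "\<sigma> > 0" and l: "l = 1 / (4 * \<sigma>\<^sup>2)"
    and meas: "P \<in> sets borel" "Q \<in> sets borel" "G \<in> sets borel"
    and cube: "P \<subseteq> unit_cube" "Q \<subseteq> unit_cube" "G \<subseteq> unit_cube"
  shows "(\<integral>\<^sup>+ z. ennreal (exp (- l * (criterion n z P - criterion n z Q))) \<partial>sample_law n \<nu> G)
    \<le> ennreal (exp (real n * (- (1 - exp (- l / 2)) * measure lebesgue (sym_diff P G)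
                 + (exp (3 * l / 2) - exp (- l / 2)) * measure lebesgue (sym_diff Q G))))"
proof -
  interpret L: prob_space "pair_law \<nu> G" by (rule prob_space_pair_law[OF nu(2,1) meas(3)])
  interpret product_sigma_finite "\<lambda>_::nat. pair_law \<nu> G" ..
  have [measurable_cong]: "sets (pair_law \<nu> G) = sets borel" by simp
  note [measurable] = meas
  have "(\<integral>\<^sup>+ z. ennreal (exp (- l * (criterion n z P - criterion n z Q))) \<partial>sample_law n \<nu> G)
      = (\<integral>\<^sup>+ z. (\<Prod>i\<in>{1..n}. ennreal (exp (- l * loss_increment P Q (z i)))) \<partial>sample_law n \<nu> G)"
    by (simp add: criterion_diff sum_distrib_left exp_sum prod_ennreal)
  also have "\<dots> = (\<Prod>i\<in>{1..n}. \<integral>\<^sup>+ p. ennreal (exp (- l * loss_increment P Q p)) \<partial>pair_law \<nu> G)"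
    unfolding sample_law_def by (rule product_nn_integral_prod) measurable
  also have "\<dots> \<le> (\<Prod>i\<in>{1..n}. ennreal (exp (- (1 - exp (- l / 2)) * measure lebesgue (sym_diff P G)
                 + (exp (3 * l / 2) - exp (- l / 2)) * measure lebesgue (sym_diff Q G))))"
    by (intro prod_mono_ennreal nn_integral_exp_loss_increment[OF nu l meas cube])
  also have "\<dots> = ennreal (exp (real n * (- (1 - exp (- l / 2)) * measure lebesgue (sym_diff P G)
                 + (exp (3 * l / 2) - exp (- l / 2)) * measure lebesgue (sym_diff Q G))))"
    by (simp add: ennreal_power exp_of_nat_mult)
  finally show ?thesis .
qed

section \<open>From exponential moments to the risk bound\<close>

text \<open>This is u \<le> exp u at \<open>u = c * y / q\<close>, raised to the power
  \<open>q\<close>.\<close>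

lemma powr_le_exp:
  fixes y q c :: real
  assumes "y \<ge> 0" "q > 0" "c > 0"
  shows "y powr q \<le> (q / c) powr q * exp (c * y)"
proof -
  have "c * y / q \<le> exp (c * y / q)" using exp_ge_add_one_self[of "c * y / q"] by linarith
  then have "(c * y / q) powr q \<le> exp (c * y / q) powr q"
    using assms by (intro powr_mono2) auto
  also have "\<dots> = exp (c * y)" using assms by (simp add: powr_def)
  finally have "(q / c) powr q * (c * y / q) powr q \<le> (q / c) powr q * exp (c * y)"
    by (intro mult_left_mono) auto
  moreover have "(q / c) powr q * (c * y / q) powr q = y powr q"
    using assms by (subst powr_mult[symmetric]) auto
  ultimately show ?thesis by simp
qed

text \<open>Above the threshold \<open>4 / c * (m * ln n / n)\<close>, half of the exponential decay absorbs \<open>x powr q\<close>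
  and the other half pays for a union bound over \<open>(n + 1) ^ m\<close> competitors.\<close>

lemma powr_exp_tail:
  fixes x q c :: real
  assumes x: "x > 4 / c * (real m * ln (real n) / real n)" "x \<ge> 0" and "q > 0" "c > 0" and n: "n \<ge> 2"
  shows "x powr q * exp (- c * real n * x) * real ((n + 1) ^ m) \<le> (2 * q / c) powr q * (1 / real n) powr q"
proof -
  have "(real n * x) powr q \<le> (q / (c / 2)) powr q * exp (c / 2 * (real n * x))"
    using assms by (intro powr_le_exp) auto
  then have "(real n * x) powr q * (1 / real n) powr q
      \<le> (2 * q / c) powr q * exp (c * real n * x / 2) * (1 / real n) powr q"
    by (intro mult_right_mono) (simp_all add: mult_ac)
  moreover have "(real n * x) powr q * (1 / real n) powr q = x powr q"
    using assms by (subst powr_mult[symmetric]) auto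
  ultimately have a: "x powr q \<le> (2 * q / c) powr q * (1 / real n) powr q * exp (c * real n * x / 2)"
    by (simp add: mult_ac)
  \<comment> \<open>For \<open>n\<close> \<ge> 2 this replaces the count by
    \<open>n ^ (2 * m)\<close>, which is \<open>exp (2 * m * ln n)\<close>.\<close>
  have "n + 1 \<le> n ^ 2"
  proof -
    have "n + 1 \<le> 2 * n" using n by simp
    also have "\<dots> \<le> n * n" using n by (intro mult_right_mono) auto
    finally show ?thesis by (simp add: power2_eq_square)
  qed
  then have "(n + 1) ^ m \<le> (n ^ 2) ^ m" by (rule power_mono) simp
  then have "real ((n + 1) ^ m) \<le> real ((n ^ 2) ^ m)" by (rule of_nat_mono)
  also have "\<dots> = real n ^ (2 * m)" by (simp add: power_mult)
  also have "\<dots> = exp (2 * real m * ln (real n))"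
    using n by (simp add: exp_of_nat_mult[of "2 * m", simplified])
  \<comment> \<open>The factor 4 in the threshold is chosen so that \<open>c * n * x / 2\<close>
    exceeds \<open>2 * m * ln n\<close>.\<close>
  also have "\<dots> \<le> exp (c * real n * x / 2)"
    using assms by (simp add: field_simps)
  finally have b: "real ((n + 1) ^ m) \<le> exp (c * real n * x / 2)" .
  have "x powr q * exp (- c * real n * x) * real ((n + 1) ^ m)
     \<le> ((2 * q / c) powr q * (1 / real n) powr q * exp (c * real n * x / 2)) * exp (- c * real n * x)
        * exp (c * real n * x / 2)"
    by (intro mult_mono a b) auto
  also have "\<dots> = (2 * q / c) powr q * (1 / real n) powr q
      * (exp (c * real n * x / 2) * exp (c * real n * x / 2) * exp (- c * real n * x))"
    by (simp only: mult_ac)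
  also have "exp (c * real n * x / 2) * exp (c * real n * x / 2) * exp (- c * real n * x) = 1"
    by (simp add: exp_add[symmetric])
  finally show ?thesis by simp
qed

text \<open>Distances up to the threshold give the term with \<open>(4 / c1) powr q\<close>
  directly. Larger distances are controlled by a sum of exponential moments over the finitely many
  distant grid polytopes.\<close>

lemma estimator_risk:
  fixes P :: "(real ^ 'd::finite) set" and Phat :: "'d sample \<Rightarrow> (real ^ 'd) set"
  assumes nu: "sets \<nu> = sets borel" "prob_space \<nu>" "subgaussian \<sigma> \<nu>" "\<sigma> > 0" and l: "l = 1 / (4 * \<sigma>\<^sup>2)"
    and q: "q > 0" and d: "CARD('d) \<ge> 2"
    and B: "B = 2 * real CARD('d) * 3 ^ CARD('d) + 1"
    and c1: "c1 = 1 - exp (- l / 2)" and c3: "c3 = exp (3 * l / 2) - exp (- l / 2)"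
    and r: "r \<ge> CARD('d) + 1" and n: "n \<ge> 2" and est: "is_estimator n r Phat" and P: "P \<in> polytopes r"
  shows "(\<integral>\<^sup>+ z. ennreal (measure lebesgue (sym_diff (Phat z) P) powr q) \<partial>sample_law n \<nu> P)
    \<le> ennreal (((4 / c1) powr q + exp (c3 * B) * (2 * q / c1) powr q)
         * (real CARD('d) * real r * ln (real n) / real n) powr q)"
proof -
  have lp: "l > 0" using nu(4) by (simp add: l)
  have c: "0 < c1" "0 \<le> c3" using lp by (auto simp: c1 c3)
  let ?\<G> = "grid_polytopes n r :: (real ^ 'd) set set"
  define R where "R = real CARD('d) * real r * ln (real n) / real n"
  define dist where "dist = (\<lambda>Q. measure lebesgue (sym_diff Q P))"
  have "1 \<le> n" using n by simp
  obtain Q where Q: "Q \<in> ?\<G>" "dist Q \<le> B / real n"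
    unfolding dist_def B using grid_approximation[OF P \<open>1 \<le> n\<close> r] by blast
  have fin: "finite ?\<G>" and card: "card ?\<G> \<le> (n + 1) ^ (CARD('d) * r)"
    using grid_polytopes_finite_card[OF \<open>1 \<le> n\<close>] by auto
  have poly: "S \<in> sets borel" "S \<subseteq> unit_cube" if "S \<in> ?\<G> \<or> S = P" for S
    using that P polytopesD(2,5)[of S r] by (auto simp: grid_polytopes_def compact_imp_closed)
  \<comment> \<open>The cutoff is the threshold of \<open>powr_exp_tail\<close> for
    \<open>c = c1\<close> and \<open>m = CARD('d) * r\<close>.\<close>
  define T where "T = {S \<in> ?\<G>. dist S > 4 / c1 * R}"
  have T: "finite T" "T \<subseteq> ?\<G>" using fin by (auto simp: T_def)
  define W where "W = (\<lambda>S z. exp (- l * (criterion n z S - criterion n z Q)))"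
  interpret L: prob_space "pair_law \<nu> P" using nu poly by (intro prob_space_pair_law) auto
  interpret prob_space "sample_law n \<nu> P"
    unfolding sample_law_def by (intro prob_space_PiM L.prob_space_axioms)
  have sp: "space (sample_law n \<nu> P) = space (sample_space n :: 'd sample measure)"
    by (simp add: sample_law_def sample_space_def space_PiM sets_eq_imp_space_eq[OF sets_pair_law])
  have sets_sl: "sets (sample_law n \<nu> P) = sets (sample_space n :: 'd sample measure)"
    unfolding sample_law_def sample_space_def by (intro sets_PiM_cong) auto
  \<comment> \<open>A pointwise form of the union and Markov bounds: as \<open>Phat z\<close>
    minimizes the criterion, \<open>W (Phat z) z\<close> \<ge> 1. When \<open>Phat z\<close> lies in
    \<open>T\<close>, its own summand already dominates the loss, and the others are
    nonnegative.\<close>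
  have ptw: "ennreal (dist (Phat z) powr q)
      \<le> ennreal ((4 / c1 * R) powr q) + (\<Sum>S\<in>T. ennreal (dist S powr q) * ennreal (W S z))"
    if "z \<in> space (sample_law n \<nu> P)" for z
  proof -
    have "is_arg_min (criterion n z) (\<lambda>S. S \<in> ?\<G>) (Phat z)"
      using est that by (simp add: is_estimator_def sp)
    then have G: "Phat z \<in> ?\<G>" and le: "criterion n z (Phat z) \<le> criterion n z Q"
      using Q(1) by (auto simp: is_arg_min_linorder)
    show ?thesis
    proof (cases "dist (Phat z) > 4 / c1 * R")
      case False
      then have "dist (Phat z) powr q \<le> (4 / c1 * R) powr q"
        using q by (intro powr_mono2) (auto simp: dist_def)
      then show ?thesis by (intro add_increasing2 ennreal_leI) (auto intro: sum_nonneg)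
    next
      case True
      with G have "Phat z \<in> T" by (simp add: T_def)
      have "1 \<le> W (Phat z) z" using le lp by (simp add: W_def mult_le_0_iff)
      then have "dist (Phat z) powr q * 1 \<le> dist (Phat z) powr q * W (Phat z) z"
        by (intro mult_left_mono) auto
      then have "ennreal (dist (Phat z) powr q) \<le> ennreal (dist (Phat z) powr q) * ennreal (W (Phat z) z)"
        by (subst ennreal_mult[symmetric]) (auto simp: W_def intro!: ennreal_leI)
      also have "\<dots> \<le> (\<Sum>S\<in>T. ennreal (dist S powr q) * ennreal (W S z))"
        using \<open>Phat z \<in> T\<close> T(1) by (intro member_le_sum) auto
      finally show ?thesis by (intro add_increasing) auto
    qed
  qed
  have crit_meas: "(\<lambda>z. criterion n z S) \<in> borel_measurable (sample_law n \<nu> P)" if "S \<in> ?\<G>" for S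
  proof -
    have [measurable]: "S \<in> sets borel" using poly that by blast
    have "(\<lambda>p. (1 - 2 * snd p) * indicator S (fst p)) \<in> borel_measurable (borel :: ((real ^ 'd) \<times> real) measure)"
      unfolding borel_prod[symmetric] by measurable
    then have "(\<lambda>z. (1 - 2 * snd (z i)) * indicator S (fst (z i)))
        \<in> borel_measurable (sample_space n :: 'd sample measure)" if "i \<in> {1..n}" for i
      unfolding sample_space_def using that
      by (intro measurable_compose[OF measurable_component_singleton[of i "{1..n}"]])
    then show ?thesis
      unfolding criterion_def measurable_cong_sets[OF sets_sl refl] by (intro borel_measurable_sum)
  qed
  have Wm: "(\<lambda>z. ennreal (W S z)) \<in> borel_measurable (sample_law n \<nu> P)" if "S \<in> T" for S
    unfolding W_def using that T(2) Q(1) crit_meas[of S] crit_meas[of Q]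
    by (intro measurable_compose[OF _ measurable_ennreal] borel_measurable_exp
      borel_measurable_times borel_measurable_diff) auto
  \<comment> \<open>The factor \<open>card T\<close> is carried along so that each summand is at
    most a \<open>card T\<close>-th part of the target, and the sum over \<open>T\<close> is then
    bounded by the target itself.\<close>
  have risk_term: "ennreal (dist S powr q) * (\<integral>\<^sup>+ z. ennreal (W S z) \<partial>sample_law n \<nu> P) * ennreal (real (card T))
      \<le> ennreal (exp (c3 * B) * (2 * q / c1) powr q * R powr q)" if "S \<in> T" for S
  proof -
    have "S \<in> ?\<G>" and big: "dist S > 4 / c1 * R" using that by (auto simp: T_def)
    have "(\<integral>\<^sup>+ z. ennreal (W S z) \<partial>sample_law n \<nu> P) \<le> ennreal (exp (real n * (- c1 * dist S + c3 * dist Q)))"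
      unfolding W_def dist_def c1 c3
      using \<open>S \<in> ?\<G>\<close> Q(1) poly by (intro nn_integral_exp_criterion[OF nu l]) auto
    also have "\<dots> \<le> ennreal (exp (c3 * B) * exp (- c1 * real n * dist S))"
    \<comment> \<open>As \<open>Q\<close> is within \<open>B / real n\<close> of \<open>P\<close>,
      its cost accumulated over \<open>n\<close> observations is at most the constant factor
      \<open>exp (c3 * B)\<close>.\<close>
    proof -
      have "real n * dist Q \<le> B" using Q(2) n by (simp add: field_simps)
      then have "c3 * (real n * dist Q) \<le> c3 * B" using c by (intro mult_left_mono)
      then show ?thesis by (simp add: exp_add[symmetric] algebra_simps)
    qed
    finally have "ennreal (dist S powr q) * (\<integral>\<^sup>+ z. ennreal (W S z) \<partial>sample_law n \<nu> P) * ennreal (real (card T))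
      \<le> ennreal (dist S powr q) * ennreal (exp (c3 * B) * exp (- c1 * real n * dist S))
          * ennreal (real ((n + 1) ^ (CARD('d) * r)))"
    proof (intro mult_mono ennreal_leI of_nat_mono)
      show "card T \<le> (n + 1) ^ (CARD('d) * r)" using card card_mono[OF fin T(2)] by simp
    qed auto
    also have "\<dots> = ennreal (exp (c3 * B) * (dist S powr q * exp (- c1 * real n * dist S) * real ((n + 1) ^ (CARD('d) * r))))"
      by (simp add: ennreal_mult[symmetric] mult_ac)
    also have "\<dots> \<le> ennreal (exp (c3 * B) * ((2 * q / c1) powr q * (1 / real n) powr q))"
      using big c q n by (intro ennreal_leI mult_left_mono powr_exp_tail) (auto simp: R_def dist_def)
    also have "\<dots> \<le> ennreal (exp (c3 * B) * ((2 * q / c1) powr q * R powr q))"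
    \<comment> \<open>The tail bound has order \<open>(1 / real n) powr q\<close>. It is absorbed
      into the rate \<open>R powr q\<close>, because \<open>CARD('d) * r\<close> \<ge> 6 and ln n
      \<ge> 1/2 give \<open>CARD('d) * r * ln n\<close> \<ge> 3.\<close>
    proof (intro ennreal_leI mult_left_mono powr_mono2)
      have "1 / 2 \<le> ln (2::real)" using ln2_ge_two_thirds by simp
      also have "\<dots> \<le> ln (real n)" using n by simp
      finally have ln: "1 / 2 \<le> ln (real n)" .
      have "2 * 3 \<le> CARD('d) * r" using d r by (intro mult_mono) auto
      then have "6 \<le> real CARD('d) * real r" by (metis of_nat_mult of_nat_mono of_nat_numeral numeral_times_numeral semiring_norm)
      then have "6 * (1 / 2) \<le> real CARD('d) * real r * ln (real n)" using ln by (intro mult_mono) auto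
      then show "1 / real n \<le> R" using n unfolding R_def by (intro divide_right_mono) auto
    qed (use q in auto)
    finally show ?thesis by (simp add: mult_ac)
  qed
  have "(\<integral>\<^sup>+ z. ennreal (dist (Phat z) powr q) \<partial>sample_law n \<nu> P)
      \<le> (\<integral>\<^sup>+ z. ennreal ((4 / c1 * R) powr q) + (\<Sum>S\<in>T. ennreal (dist S powr q) * ennreal (W S z)) \<partial>sample_law n \<nu> P)"
    by (intro nn_integral_mono ptw)
  also have "\<dots> = ennreal ((4 / c1 * R) powr q) + (\<Sum>S\<in>T. ennreal (dist S powr q) * (\<integral>\<^sup>+ z. ennreal (W S z) \<partial>sample_law n \<nu> P))"
    using Wm by (subst nn_integral_add) (auto simp: nn_integral_sum nn_integral_cmult emeasure_space_1)
  also have "\<dots> \<le> ennreal ((4 / c1 * R) powr q) + ennreal (exp (c3 * B) * (2 * q / c1) powr q * R powr q)"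
  proof (rule add_left_mono, cases "T = {}")
    case False
    let ?K = "exp (c3 * B) * (2 * q / c1) powr q * R powr q"
    have pos: "0 < real (card T)" using False T(1) by (simp add: card_gt_0_iff)
    have "ennreal (dist S powr q) * (\<integral>\<^sup>+ z. ennreal (W S z) \<partial>sample_law n \<nu> P) \<le> ennreal (?K / real (card T))"
      if "S \<in> T" for S
    proof -
      let ?a = "ennreal (dist S powr q) * (\<integral>\<^sup>+ z. ennreal (W S z) \<partial>sample_law n \<nu> P)"
      have "?a = ?a * ennreal (real (card T)) * ennreal (1 / real (card T))"
        using pos by (simp add: mult.assoc ennreal_mult[symmetric] del: ennreal_of_nat_eq_real_of_nat)
      also have "\<dots> \<le> ennreal ?K * ennreal (1 / real (card T))"
        by (intro mult_right_mono risk_term that) auto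
      also have "\<dots> = ennreal (?K / real (card T))" by (subst ennreal_mult[symmetric]) auto
      finally show ?thesis .
    qed
    then have "(\<Sum>S\<in>T. ennreal (dist S powr q) * (\<integral>\<^sup>+ z. ennreal (W S z) \<partial>sample_law n \<nu> P))
        \<le> (\<Sum>S\<in>T. ennreal (?K / real (card T)))"
      by (rule sum_mono)
    also have "\<dots> = ennreal (\<Sum>S\<in>T. ?K / real (card T))" by (intro sum_ennreal) auto
    also have "\<dots> = ennreal ?K" using pos by simp
    finally show "(\<Sum>S\<in>T. ennreal (dist S powr q) * (\<integral>\<^sup>+ z. ennreal (W S z) \<partial>sample_law n \<nu> P)) \<le> ennreal ?K" .
  qed simp
  also have "\<dots> = ennreal (((4 / c1) powr q + exp (c3 * B) * (2 * q / c1) powr q) * R powr q)"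
  proof -
    have "(4 / c1 * R) powr q = (4 / c1) powr q * R powr q"
      by (rule powr_mult)
    then show ?thesis by (simp only: ennreal_plus[symmetric] distrib_right powr_ge_zero mult_nonneg_nonneg exp_ge_zero)
  qed
  finally show ?thesis by (simp add: dist_def R_def)
qed

theorem corollary1:
  fixes q \<sigma> :: real
  assumes "CARD('d::finite) \<ge> 2" and "q > 0" and "\<sigma> > 0"
  shows "\<exists>A::real. \<forall>(\<nu>::real measure) (r::nat) (n::nat) (Phat :: 'd sample \<Rightarrow> (real ^ 'd) set).
    prob_space \<nu> \<longrightarrow> sets \<nu> = sets borel \<longrightarrow> subgaussian \<sigma> \<nu> \<longrightarrow>
    r \<ge> CARD('d) + 1 \<longrightarrow> n \<ge> 2 \<longrightarrow> is_estimator n r Phat \<longrightarrow>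
    (SUP P \<in> polytopes r.
       \<integral>\<^sup>+ z. ennreal (measure lebesgue (sym_diff (Phat z) P) powr q) \<partial>sample_law n \<nu> P)
    \<le> ennreal (A * (real CARD('d) * real r * ln (real n) / real n) powr q)"
  \<comment> \<open>The equations for \<open>l\<close>, \<open>B\<close>, \<open>c1\<close> and
    \<open>c3\<close> are discharged by \<open>refl\<close>. The resulting constant involves only
    \<open>q\<close>, \<open>\<sigma>\<close> and the dimension, so it can be chosen before the
    noise law, \<open>r\<close>, \<open>n\<close> and the estimator.\<close>
  using estimator_risk[OF _ _ _ assms(3) refl assms(2,1) refl refl refl]
  by (intro exI allI impI SUP_least) blast

end
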